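(* Let $\mathcal{L}$ be the set of all lattice triangles. The set of points of $\mathcal{M}_\Delta$ determined by the triangles in $\mathcal{L}$, i.e. $\{\,p(\Delta) : \Delta\in\mathcal{L}\,\}$, is dense in $\mathcal{M}_\Delta$.
   Context: A lattice triangle is a (nondegenerate) triangle in the plane $\mathbb{R}^2$ whose three vertices lie in the integer lattice $\mathbb{Z}^2=\{(m,n) : m,n\in\mathbb{Z}\}$. The moduli space of triangles $\mathcal{M}_\Delta$ is the set of triangles in $\mathbb{R}^2$ up to similarity (composition of a translation, rotation and/or reflection with a scaling). It is parametrized by side-lengths normalized so that their sum is $2$, and so is identified with $$\mathcal{M}_\Delta=\{(a,b,c)\in\mathbb{R}^3 : a,b,c>0,\ a\le b\le c<1,\ a+b+c=2\},$$ with the topology induced from the Euclidean topology of $\mathbb{R}^3$. A lattice triangle $\Delta$ with vertices $A,B,C\in\mathbb{Z}^2$ determines the point $p(\Delta)\in\mathcal{M}_\Delta$ obtained by listing in non-decreasing order the three numbers $\frac1s\lVert B-A\rVert$, $\frac1s\lVert C-B\rVert$, $\frac1s\lVert A-C\rVert$, where $\lVert\cdot\rVert$ is the Euclidean norm and $s=\frac12(\lVert B-A\rVert+\lVert C-B\rVert+\lVert A-C\rVert)$ is the semi-perimeter. *)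

theory Defs
  imports "HOL-Analysis.Analysis"
begin

definition integer_lattice :: "(real^2) set" where
  "integer_lattice = {x. \<forall>i. x $ i \<in> \<int>}"

text \<open>A triangle is given by its ordered triple of vertices; \<open>shape\<close> below does not depend on
  the order.\<close>

definition lattice_triangles :: "((real^2) \<times> (real^2) \<times> (real^2)) set" where
  "lattice_triangles =
     {(A, B, C). A \<in> integer_lattice \<and> B \<in> integer_lattice \<and> C \<in> integer_lattice \<and>
        \<not> collinear {A, B, C}}"

definition triangle_moduli :: "(real^3) set" where
  "triangle_moduli =
     {x. 0 < x $ 1 \<and> 0 < x $ 2 \<and> 0 < x $ 3 \<and>
         x $ 1 \<le> x $ 2 \<and> x $ 2 \<le> x $ 3 \<and> x $ 3 < 1 \<and> x $ 1 + x $ 2 + x $ 3 = 2}"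

fun semiperimeter :: "(real^2) \<times> (real^2) \<times> (real^2) \<Rightarrow> real" where
  "semiperimeter (A, B, C) = (norm (B - A) + norm (C - B) + norm (A - C)) / 2"

fun shape :: "(real^2) \<times> (real^2) \<times> (real^2) \<Rightarrow> real^3" where
  "shape (A, B, C) =
     (let s = semiperimeter (A, B, C)
      in vector (sort [norm (B - A) / s, norm (C - B) / s, norm (A - C) / s]))"

lemma norm_side_less:
  fixes A B C :: "real^2"
  assumes "\<not> collinear {A, B, C}"
  shows "norm (A - C) < norm (B - A) + norm (C - B)"
proof -
  have "\<not> between (A, C) B"
    using assms by (metis between_imp_collinear insert_commute)
  then have "dist A C \<noteq> dist A B + dist B C"
    by (simp add: between)
  with dist_triangle[of A C B] show ?thesis
    by (simp add: dist_norm norm_minus_commute)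
qed

lemma shape_in_triangle_moduli:
  assumes "T \<in> lattice_triangles"
  shows "shape T \<in> triangle_moduli"
proof -
  obtain A B C where T: "T = (A, B, C)" and nc: "\<not> collinear {A, B, C}"
    using assms by (auto simp: lattice_triangles_def)
  define s where "s = semiperimeter T"
  have nc': "\<not> collinear {B, C, A}" "\<not> collinear {C, A, B}"
    using nc by (simp_all add: insert_commute)
  have sides: "norm (A - C) < s" "norm (B - A) < s" "norm (C - B) < s"
    using norm_side_less[OF nc] norm_side_less[OF nc'(1)] norm_side_less[OF nc'(2)]
    by (simp_all add: s_def T)
  have "A \<noteq> B" "B \<noteq> C" "C \<noteq> A"
    using nc by (auto simp: insert_commute)
  then have pos: "0 < norm (A - C)" "0 < norm (B - A)" "0 < norm (C - B)" "0 < s"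
    using sides by (auto intro: le_less_trans[OF norm_ge_zero])
  define l where "l = [norm (B - A) / s, norm (C - B) / s, norm (A - C) / s]"
  have "norm (B - A) + norm (C - B) + norm (A - C) = 2 * s"
    by (simp add: s_def T)
  then have "(norm (B - A) + norm (C - B) + norm (A - C)) / s = 2"
    using pos(4) by simp
  then have "sum_list l = 2"
    by (simp add: l_def add_divide_distrib)
  have l01: "\<forall>x\<in>set l. 0 < x \<and> x < 1"
    using pos sides by (simp add: l_def)
  have "length (sort l) = 3"
    by (simp only: length_sort) (simp add: l_def)
  then obtain a b c where abc: "sort l = [a, b, c]"
    by (auto simp only: numeral_3_eq_3 length_Suc_conv length_0_conv)
  have "sorted [a, b, c]" "set [a, b, c] = set l"
    using sorted_sort[of l] set_sort[of "\<lambda>x. x" l] by (simp_all only: abc)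
  moreover have "sum_list [a, b, c] = 2"
    using \<open>sum_list l = 2\<close> by (metis abc mset_sort sum_mset_sum_list)
  ultimately have "0 < a" "0 < b" "0 < c" "a \<le> b" "b \<le> c" "c < 1" "a + b + c = 2"
    using l01 by auto
  moreover have "shape T = vector [a, b, c]"
    using abc by (simp add: T s_def l_def Let_def del: semiperimeter.simps)
  ultimately show ?thesis
    by (simp add: triangle_moduli_def)
qed

end

theory Submission
  imports Defs
begin

text \<open>Place a Euclidean triangle with the prescribed side lengths in the plane, dilate it by a
  large factor \<open>n\<close> and round its vertices down to lattice points. After rescaling by \<open>1 / n\<close> the
  vertices converge to those of the original triangle, and the shape is scale invariant and
  continuous.\<close>

text \<open>The middle entry is what remains of the total once both extremes are removed. This turns
  sorting into an expression in \<open>min\<close>, \<open>max\<close> and sums, whose continuity is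
  immediate.\<close>

lemma sort_three:
  fixes p q r :: "'a :: linordered_ab_group_add"
  shows "sort [p, q, r] =
    [min p (min q r), p + q + r - min p (min q r) - max p (max q r), max p (max q r)]"
  by (auto simp: min_def max_def algebra_simps)

lemma shape_components:
  fixes A B C :: "real^2"
  defines "s \<equiv> semiperimeter (A, B, C)"
  defines "p \<equiv> norm (B - A) / s" and "q \<equiv> norm (C - B) / s" and "r \<equiv> norm (A - C) / s"
  shows "shape (A, B, C) =
    vector [min p (min q r), p + q + r - min p (min q r) - max p (max q r), max p (max q r)]"
  unfolding shape.simps Let_def sort_three s_def p_def q_def r_def ..

lemma shape_scaleR:
  assumes "t > 0"
  shows "shape (t *\<^sub>R A, t *\<^sub>R B, t *\<^sub>R C) = shape (A, B, C)"
proof -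
  have "semiperimeter (t *\<^sub>R A, t *\<^sub>R B, t *\<^sub>R C) = t * semiperimeter (A, B, C)"
    using assms by (simp flip: scaleR_diff_right add: distrib_left)
  then show ?thesis
    using assms
    by (simp only: shape.simps Let_def flip: scaleR_diff_right) simp
qed

lemma tendsto_shape:
  assumes "(A \<longlongrightarrow> a) F" "(B \<longlongrightarrow> b) F" "(C \<longlongrightarrow> c) F"
    and "semiperimeter (a, b, c) \<noteq> 0"
  shows "((\<lambda>n. shape (A n, B n, C n)) \<longlongrightarrow> shape (a, b, c)) F"
proof -
  have "((\<lambda>n. semiperimeter (A n, B n, C n)) \<longlongrightarrow> semiperimeter (a, b, c)) F"
    unfolding semiperimeter.simps by (intro tendsto_intros assms) simp
  note [tendsto_intros] = this tendsto_min tendsto_max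
  show ?thesis
    unfolding shape_components
    by (rule vec_tendstoI, rule forall_3[THEN iffD2, rule_format])
      (auto simp del: semiperimeter.simps intro!: tendsto_intros assms)
qed

text \<open>Three points are collinear iff one lies between the other two, which is equality in a
  triangle inequality. The form with strict inequalities is visibly an open condition and depends on
  the side lengths alone.\<close>

lemma not_collinear_iff_norm:
  fixes A B C :: "'a :: euclidean_space"
  shows "\<not> collinear {A, B, C} \<longleftrightarrow>
    norm (B - A) < norm (C - B) + norm (A - C) \<and>
    norm (C - B) < norm (A - C) + norm (B - A) \<and>
    norm (A - C) < norm (B - A) + norm (C - B)"
  using dist_triangle[of A B C] dist_triangle[of B C A] dist_triangle[of C A B]
  unfolding collinear_between_cases between dist_norm
  by (auto simp: norm_minus_commute)

lemma eventually_not_collinear: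
  fixes a b c :: "'a :: euclidean_space"
  assumes "(A \<longlongrightarrow> a) F" "(B \<longlongrightarrow> b) F" "(C \<longlongrightarrow> c) F" and "\<not> collinear {a, b, c}"
  shows "eventually (\<lambda>n. \<not> collinear {A n, B n, C n}) F"
proof -
  have less: "eventually (\<lambda>n. f n < g n) F"
    if "(f \<longlongrightarrow> k) F" "(g \<longlongrightarrow> l) F" "k < l" for f g k and l :: real
    \<comment> \<open>The difference \<open>g - f\<close> tends to \<open>l - k > 0\<close>, so it
      is eventually positive.\<close>
    using order_tendstoD(1)[OF tendsto_diff[OF that(2,1)], of 0] that(3) by simp
  show ?thesis
    using assms(4) unfolding not_collinear_iff_norm
    by (intro eventually_conj; elim conjE) (rule less; (assumption | intro tendsto_intros assms))+
qed

text \<open>Used in contrapositive form: if the rescaled rounded points are not collinear, neither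
  are the lattice points themselves.\<close>

lemma collinear_scaleR:
  assumes "collinear {A, B, C}"
  shows "collinear {t *\<^sub>R A, t *\<^sub>R B, t *\<^sub>R C}"
proof -
  obtain u where "\<forall>x\<in>{A, B, C}. \<forall>y\<in>{A, B, C}. \<exists>k. x - y = k *\<^sub>R u"
    using assms by (auto simp: collinear_def)
  then have "\<forall>x\<in>{A, B, C}. \<forall>y\<in>{A, B, C}. \<exists>k. t *\<^sub>R x - t *\<^sub>R y = k *\<^sub>R u"
    by (metis scaleR_diff_right scaleR_scaleR)
  then show ?thesis
    unfolding collinear_def by (intro exI[of _ u]) blast
qed

definition lattice_floor :: "real^2 \<Rightarrow> real^2" where
  "lattice_floor x = (\<chi> i. of_int \<lfloor>x $ i\<rfloor>)"

lemma lattice_floor_in_lattice: "lattice_floor x \<in> integer_lattice"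
  by (simp add: lattice_floor_def integer_lattice_def)

text \<open>Rounding moves each coordinate by less than 1, hence by less than \<open>1 / n\<close>
  after rescaling.\<close>

lemma tendsto_lattice_floor:
  "(\<lambda>n. (1 / real n) *\<^sub>R lattice_floor (real n *\<^sub>R x)) \<longlonglongrightarrow> x"
proof (rule vec_tendstoI)
  fix i
  have "(\<lambda>n. of_int \<lfloor>real n * x $ i\<rfloor> / real n) \<longlonglongrightarrow> x $ i"
  proof (rule tendsto_sandwich)
    show "(\<lambda>n. x $ i - 1 / real n) \<longlonglongrightarrow> x $ i"
      using tendsto_diff[OF tendsto_const lim_1_over_n] by simp
    show "\<forall>\<^sub>F n in sequentially. x $ i - 1 / real n \<le> of_int \<lfloor>real n * x $ i\<rfloor> / real n"
      using eventually_gt_at_top[of 0]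
    proof eventually_elim
      case (elim n)
      have "real n * x $ i - 1 \<le> of_int \<lfloor>real n * x $ i\<rfloor>"
        by linarith
      then have "(real n * x $ i - 1) / real n \<le> of_int \<lfloor>real n * x $ i\<rfloor> / real n"
        by (rule divide_right_mono) simp
      with elim show ?case
        by (simp add: diff_divide_distrib)
    qed
    show "\<forall>\<^sub>F n in sequentially. of_int \<lfloor>real n * x $ i\<rfloor> / real n \<le> x $ i"
      using eventually_gt_at_top[of 0]
    proof eventually_elim
      case (elim n)
      have "of_int \<lfloor>real n * x $ i\<rfloor> \<le> real n * x $ i"
        by linarith
      with elim show ?case
        by (simp add: field_simps)
    qed
  qed simp
  then show "(\<lambda>n. ((1 / real n) *\<^sub>R lattice_floor (real n *\<^sub>R x)) $ i) \<longlonglongrightarrow> x $ i"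
    by (simp add: lattice_floor_def)
qed

lemma triangle_moduli_realized:
  assumes "x \<in> triangle_moduli"
  obtains A B C where "\<not> collinear {A, B, C}" "shape (A, B, C) = x"
proof -
  define a b c where "a = x $ 1" and "b = x $ 2" and "c = x $ 3"
  have x: "0 < a" "a \<le> b" "b \<le> c" "c < 1" "a + b + c = 2"
    using assms by (auto simp: triangle_moduli_def a_def b_def c_def)
  \<comment> \<open>With A at the origin and C at (c, 0), the law of cosines forces \<open>u\<close>
    as the first coordinate of B; \<open>v\<close> is the height of B over AC.\<close>
  define u where "u = (a\<^sup>2 + c\<^sup>2 - b\<^sup>2) / (2 * c)"
  define v where "v = sqrt (a\<^sup>2 - u\<^sup>2)"
  have uc: "2 * u * c = a\<^sup>2 + c\<^sup>2 - b\<^sup>2"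
    using x by (simp add: u_def)
  \<comment> \<open>Heron's formula: both sides are 16 times the squared area. The last factor is
    positive because c < 1 and a + b + c = 2 give a + b > c; the others are positive by the ordering
    of the sides. So the square root defining \<open>v\<close> is taken of a positive
    number.\<close>
  have "(2 * a * c)\<^sup>2 - (2 * u * c)\<^sup>2 = (a + b + c) * (a + c - b) * (b + c - a) * (a + b - c)"
    unfolding uc by (simp add: power2_eq_square algebra_simps)
  also have "\<dots> > 0"
    using x by simp
  finally have "(a\<^sup>2 - u\<^sup>2) * (2 * c)\<^sup>2 > 0"
    by (simp add: power_mult_distrib algebra_simps)
  then have v: "v\<^sup>2 = a\<^sup>2 - u\<^sup>2"
    by (simp add: v_def zero_less_mult_iff)
  define A B C :: "real^2" where "A = 0" and "B = vector [u, v]" and "C = vector [c, 0]"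
  have AB: "norm (B - A) = a"
    using x v by (simp add: A_def B_def norm_vec_def L2_set_def sum_2)
  have "(c - u)\<^sup>2 + v\<^sup>2 = b\<^sup>2"
    using uc v by (simp add: power2_eq_square algebra_simps)
  then have BC: "norm (C - B) = b"
    using x by (simp add: B_def C_def norm_vec_def L2_set_def sum_2)
  have CA: "norm (A - C) = c"
    using x by (simp add: A_def C_def norm_vec_def L2_set_def sum_2)
  show thesis
  proof (rule that)
    show "\<not> collinear {A, B, C}"
      unfolding not_collinear_iff_norm AB BC CA using x by auto
    have "sort [a, b, c] = [a, b, c]"
      using x by simp
    \<comment> \<open>The perimeter is 2, so the semiperimeter is 1 and normalization changes
      nothing.\<close>
    then have "shape (A, B, C) = vector [a, b, c]"
      using x by (simp add: AB BC CA)
    also have "\<dots> = x"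
      by (simp add: vec_eq_iff forall_3 a_def b_def c_def)
    finally show "shape (A, B, C) = x" .
  qed
qed

theorem theorem1p1:
  shows "top_of_set triangle_moduli closure_of (shape ` lattice_triangles) = triangle_moduli"
proof -
  have "x \<in> closure (shape ` lattice_triangles)" if mod: "x \<in> triangle_moduli" for x
  proof -
    obtain A B C where nc: "\<not> collinear {A, B, C}" and x: "shape (A, B, C) = x"
      using triangle_moduli_realized[OF mod] .
    define R where "R n P = lattice_floor (real n *\<^sub>R P)" for n P
    note lim = tendsto_lattice_floor[folded R_def]
    have "semiperimeter (A, B, C) \<noteq> 0"
      using norm_side_less[OF nc] norm_ge_zero[of "A - C"] by (simp, linarith)
    then have "(\<lambda>n. shape ((1 / real n) *\<^sub>R R n A, (1 / real n) *\<^sub>R R n B, (1 / real n) *\<^sub>R R n C))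
        \<longlonglongrightarrow> x"
      unfolding x[symmetric] by (intro tendsto_shape lim)
    \<comment> \<open>The rescaled vertices need not be lattice points, but for n > 0 their shape is
      that of the lattice triple \<open>R n A\<close>, \<open>R n B\<close>, \<open>R n C\<close>,
      which is eventually nondegenerate because the limit triangle is.\<close>
    moreover have "\<forall>\<^sub>F n in sequentially.
        shape ((1 / real n) *\<^sub>R R n A, (1 / real n) *\<^sub>R R n B, (1 / real n) *\<^sub>R R n C)
          \<in> shape ` lattice_triangles"
      using eventually_not_collinear[OF lim lim lim nc] eventually_gt_at_top[of 0]
    proof eventually_elim
      case (elim n)
      then have "(R n A, R n B, R n C) \<in> lattice_triangles"
        by (auto simp: lattice_triangles_def R_def lattice_floor_in_lattice dest: collinear_scaleR)
      moreover have "shape ((1 / real n) *\<^sub>R R n A, (1 / real n) *\<^sub>R R n B, (1 / real n) *\<^sub>R R n C)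
          = shape (R n A, R n B, R n C)"
        using elim by (intro shape_scaleR) simp
      ultimately show ?case
        by (metis imageI)
    qed
    ultimately show ?thesis
      by (elim Lim_in_closed_set[OF closed_closure _ sequentially_bot, rotated] eventually_mono
          subsetD[OF closure_subset])
  qed
  moreover have "shape ` lattice_triangles \<subseteq> triangle_moduli"
    using shape_in_triangle_moduli by blast
  \<comment> \<open>This is the closure in the subspace topology written out; the inner intersection
    collapses because all shapes lie in \<open>triangle_moduli\<close>.\<close>
  ultimately have "triangle_moduli \<inter> closure (triangle_moduli \<inter> shape ` lattice_triangles) =
      triangle_moduli"
    by (simp only: Int_absorb1 Int_absorb2 subsetI)
  then show ?thesis
    by (simp only: closure_of_subtopology euclidean_closure_of)
qed

end
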